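(* For every $n\ge 2$, the code $\mathcal C_n$ is not convex.
   Context: A code is a subset $\mathcal C\subseteq 2^{[N]}$. Given convex open sets $U_1,\ldots,U_N$ contained in a convex open set $X\subseteq\mathbb R^d$, their code is $\{\sigma\subseteq[N]\mid \bigcap_{i\in\sigma}U_i\setminus\bigcup_{j\notin\sigma}U_j\neq\emptyset\}$, where the empty intersection is $X$. A code is convex if it equals the code of some such collection $U_1,\ldots,U_N,X$ in some $\mathbb R^d$. For $n\ge2$, $\mathcal C_n\subseteq 2^{[2n+2]}$ is the code consisting of: (i) $\emptyset$; (ii) $\sigma\cup\{n+1\}$ for every nonempty proper subset $\sigma\subsetneq[n]$; (iii) $\{n+1+i\}$ for $1\le i\le n+1$; (iv) $([n]\setminus\{i\})\cup\{n+1\}\cup\{n+1+i\}$ for $1\le i\le n$; (v) $[n]\cup\{n+1\}\cup\{2n+2\}$; (vi) $\{n+2,n+3,\ldots,2n+2\}$. *)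

theory Defs
  imports "HOL-Analysis.Analysis"
begin

text \<open>The neurons are \<open>1, \<dots>, N\<close>. Intersecting with \<open>X\<close> implements the convention that the empty
  intersection is \<open>X\<close>; it changes nothing for nonempty \<open>\<sigma>\<close> when every \<open>U i\<close> is contained in \<open>X\<close>.
  Values \<open>U i\<close> with \<open>i \<notin> {1..N}\<close> are irrelevant.\<close>

definition code_of :: "nat \<Rightarrow> 'a set \<Rightarrow> (nat \<Rightarrow> 'a set) \<Rightarrow> nat set set" where
  "code_of N X U =
     {\<sigma>. \<sigma> \<subseteq> {1..N} \<and> (X \<inter> (\<Inter>i\<in>\<sigma>. U i)) - (\<Union>j\<in>{1..N} - \<sigma>. U j) \<noteq> {}}"

text \<open>Realizability in Euclidean space of dimension \<open>CARD('d)\<close>. A code is convex iff this holds for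
  some finite type \<open>'d\<close>, hence non-convex iff it fails for every \<open>'d\<close>. The zero-dimensional space, which
  is not of the form \<open>real ^ 'd\<close>, adds nothing: see \<open>convex_code_in_if_realized_in_point\<close>.\<close>

definition convex_code_in :: "'d::finite itself \<Rightarrow> nat \<Rightarrow> nat set set \<Rightarrow> bool" where
  "convex_code_in (_ :: 'd itself) N C \<longleftrightarrow>
     (\<exists>(X :: (real ^ 'd) set) (U :: nat \<Rightarrow> (real ^ 'd) set).
        open X \<and> convex X \<and>
        (\<forall>i\<in>{1..N}. open (U i) \<and> convex (U i) \<and> U i \<subseteq> X) \<and>
        C = code_of N X U)"

lemma code_of_iff:
  "\<sigma> \<in> code_of N X U \<longleftrightarrow> \<sigma> \<subseteq> {1..N} \<and>
     (\<exists>p. p \<in> X \<and> (\<forall>i\<in>\<sigma>. p \<in> U i) \<and> (\<forall>j\<in>{1..N} - \<sigma>. p \<notin> U j))"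
  unfolding code_of_def ex_in_conv[symmetric] by simp

lemma convex_code_in_if_realized_in_point:
  fixes X :: "unit set" and U :: "nat \<Rightarrow> unit set"
  assumes "\<forall>i\<in>{1..N}. U i \<subseteq> X"
  shows "convex_code_in TYPE('d::finite) N (code_of N X U)"
proof -
  define lift :: "unit set \<Rightarrow> (real ^ 'd) set" where "lift S = {_. () \<in> S}" for S
  have "open (lift S)" "convex (lift S)" for S
    by (cases "() \<in> S"; simp add: lift_def)+
  moreover have "lift (U i) \<subseteq> lift X" if "i \<in> {1..N}" for i
    using assms that by (auto simp: lift_def)
  moreover have "code_of N X U = code_of N (lift X) (\<lambda>i. lift (U i))"
  proof (rule set_eqI)
    fix \<sigma>
    have unit_ex: "(\<exists>p :: unit. P p) \<longleftrightarrow> P ()" for P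
      by (metis old.unit.exhaust)
    show "\<sigma> \<in> code_of N X U \<longleftrightarrow> \<sigma> \<in> code_of N (lift X) (\<lambda>i. lift (U i))"
      unfolding code_of_iff unit_ex lift_def mem_Collect_eq by blast
  qed
  ultimately show ?thesis
    unfolding convex_code_in_def
    by (intro exI[of _ "lift X"] exI[of _ "\<lambda>i. lift (U i)"]) simp
qed

definition code_C :: "nat \<Rightarrow> nat set set" where
  "code_C n =
     {{}}
     \<union> {\<sigma> \<union> {n + 1} | \<sigma>. \<sigma> \<noteq> {} \<and> \<sigma> \<subset> {1..n}}
     \<union> {{n + 1 + i} | i. i \<in> {1..n + 1}}
     \<union> {({1..n} - {i}) \<union> {n + 1} \<union> {n + 1 + i} | i. i \<in> {1..n}}
     \<union> {{1..n} \<union> {n + 1} \<union> {2 * n + 2}}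
     \<union> {{n + 2..2 * n + 2}}"

lemma code_C_subset: "code_C n \<subseteq> Pow {1..2 * n + 2}"
  by (auto simp: code_C_def)

end

(* A Brouwer argument of KKM type shows that open convex U_1, ..., U_n covering the convex hull of
   points p_1, ..., p_n, with p_j in U_i for i \<noteq> j, have a common point in that hull. In a
   realization of the code choose p_i in the i-th petal U_(n+1+i) and in U_(n+1). The sets
   U_1, ..., U_n cover U_(n+1), so they meet at some q in the hull of the p_i, and q lies in the last
   petal U_(2n+2). A point of one petal that lies in the convex hull of the other petals must
   belong to the center C of the sunflower, in every dimension: near a boundary point z of C inside
   that petal the other petals coincide with C, so shrinking towards z a convex combination that
   represents z puts all its points, hence z, into C. But C misses U_1. *)

theory Submission
  imports Defs
begin

text \<open>\<open>C\<close> is open, and \<open>closure_step\<close> makes it relatively closed in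
  the convex set \<open>Q \<inter> convex hull (\<Union>F)\<close>; by connectedness, a segment in
  that set with an end in \<open>C\<close> stays in \<open>C\<close>.\<close>

lemma sunflower_petal_Int_convex_hull:
  fixes Q C :: "'a::euclidean_space set"
  assumes Q: "open Q" "convex Q"
    and F: "\<And>P. P \<in> F \<Longrightarrow> open P \<and> convex P \<and> P \<inter> Q = C"
    and C: "C \<noteq> {}"
  shows "Q \<inter> convex hull (\<Union>F) \<subseteq> C"
proof
  fix q assume q: "q \<in> Q \<inter> convex hull (\<Union>F)"
  then have "\<Union>F \<noteq> {}"
    by force
  then obtain P where P: "P \<in> F"
    by blast
  have opC: "open C" and convC: "convex C" and CQ: "C \<subseteq> Q"
    using F[OF P] Q convex_Int by auto
  have C_sub: "C \<subseteq> R" if "R \<in> F" for R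
    using F[OF that] by blast
  have closure_step: "z \<in> C"
    if clz: "z \<in> closure C" and zQ: "z \<in> Q" and hull: "z \<in> convex hull (\<Union>F)" for z
  proof -
    \<comment> \<open>Caratheodory provides a finite \<open>T\<close>, so that below a single
      \<open>e\<close> serves all \<open>y\<close> in \<open>T\<close>.\<close>
    obtain T where T: "finite T" "T \<subseteq> \<Union>F" "z \<in> convex hull T"
      using hull unfolding caratheodory[of "\<Union>F"] by blast
    \<comment> \<open>With \<open>y\<close> in an open petal \<open>R\<close> and \<open>z\<close>
      in its closure, the points strictly between them lie in \<open>R\<close>; near
      \<open>z\<close> they also lie in \<open>Q\<close>, and
      \<open>R \<inter> Q = C\<close>.\<close>
    have "\<forall>\<^sub>F e in at_right (0::real). z + e *\<^sub>R (y - z) \<in> C" if "y \<in> T" for y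
    proof -
      obtain R where R: "R \<in> F" "y \<in> R"
        using T \<open>y \<in> T\<close> by blast
      have "((\<lambda>e::real. z + e *\<^sub>R (y - z)) \<longlongrightarrow> z + 0 *\<^sub>R (y - z)) (at_right 0)"
        by (intro tendsto_intros)
      then have nearQ: "\<forall>\<^sub>F e in at_right (0::real). z + e *\<^sub>R (y - z) \<in> Q"
        using topological_tendstoD[OF _ Q(1)] zQ by fastforce
      have small: "\<forall>\<^sub>F e in at_right (0::real). 0 < e \<and> e < 1"
        by (auto simp: eventually_at_right_field intro!: exI[of _ 1])
      from nearQ small show ?thesis
      proof eventually_elim
        case (elim e)
        have "y \<in> interior R" "z \<in> closure R" "convex R"
          using F[OF R(1)] R clz closure_mono[OF C_sub[OF R(1)]] by (auto simp: interior_open)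
        then have "z - e *\<^sub>R (z - y) \<in> R"
          using mem_interior_closure_convex_shrink[of R y z e] elim interior_subset[of R] by auto
        then have "z + e *\<^sub>R (y - z) \<in> R"
          by (simp add: algebra_simps)
        then show ?case
          using elim F[OF R(1)] by blast
      qed
    qed
    then have "\<forall>\<^sub>F e in at_right (0::real). \<forall>y\<in>T. z + e *\<^sub>R (y - z) \<in> C"
      using T(1) by (intro eventually_ball_finite) auto
    then obtain e :: real where e: "\<forall>y\<in>T. z + e *\<^sub>R (y - z) \<in> C"
      using eventually_happens'[of "at_right (0::real)"] by auto
    \<comment> \<open>The homothety with centre \<open>z\<close> and ratio \<open>e\<close> is put
      in the form \<open>a + e *\<^sub>R x\<close> to suit \<open>convex_hull_affinity\<close>; it
      fixes \<open>z\<close>.\<close>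
    define a where "a = z - e *\<^sub>R z"
    have "(\<lambda>x. a + e *\<^sub>R x) ` T \<subseteq> C"
      using e by (auto simp: a_def algebra_simps)
    then have "convex hull ((\<lambda>x. a + e *\<^sub>R x) ` T) \<subseteq> C"
      using convC by (rule hull_minimal)
    then have "a + e *\<^sub>R z \<in> C"
      using T(3) unfolding convex_hull_affinity by blast
    then show ?thesis
      by (simp add: a_def)
  qed
  obtain c where c: "c \<in> C"
    using C by blast
  let ?S = "closed_segment q c"
  have "c \<in> convex hull (\<Union>F)"
    using c C_sub[OF P] P by (intro hull_inc) blast
  then have S: "?S \<subseteq> Q" "?S \<subseteq> convex hull (\<Union>F)"
    using q c CQ Q by (auto intro!: closed_segment_subset convex_convex_hull del: subsetI)
  have "?S \<inter> C = ?S \<inter> closure C"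
    using closure_step S closure_subset[of C] by blast
  then have "closedin (top_of_set ?S) (?S \<inter> C)"
    by (simp add: closedin_closed_Int)
  moreover have "openin (top_of_set ?S) (?S \<inter> C)"
    using opC by (rule openin_open_Int)
  ultimately have "?S \<inter> C = {} \<or> ?S \<inter> C = ?S"
    using connected_segment[of q c] unfolding connected_clopen by blast
  then show "q \<in> C"
    using c by auto
qed

text \<open>Brouwer is applied to the average \<open>f\<close> of the \<open>p i\<close>, weighted
  by the distance to the complement of \<open>U i\<close>. If the fixed point missed
  \<open>U j\<close>, the weight of \<open>p j\<close> would vanish, leaving a convex combination of
  points of \<open>U j\<close>.\<close>

lemma open_cover_convex_hull_common_point:
  fixes p :: "'i \<Rightarrow> 'a::euclidean_space"
  assumes I: "finite I" "I \<noteq> {}"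
    and U: "\<And>i. i \<in> I \<Longrightarrow> open (U i)" "\<And>i. i \<in> I \<Longrightarrow> convex (U i)"
    and p: "\<And>i j. i \<in> I \<Longrightarrow> j \<in> I \<Longrightarrow> i \<noteq> j \<Longrightarrow> p j \<in> U i"
    and cover: "convex hull (p ` I) \<subseteq> (\<Union>i\<in>I. U i)"
  obtains x where "x \<in> convex hull (p ` I)" "\<And>i. i \<in> I \<Longrightarrow> x \<in> U i"
proof (cases "\<exists>i\<in>I. p i \<in> U i")
  case True
  then obtain i where "i \<in> I" "p i \<in> U i"
    by blast
  then show ?thesis
    using that[of "p i"] p hull_inc[of "p i" "p ` I"] by blast
next
  case False
  define D where "D = convex hull (p ` I)"
  define d where "d i x = infdist x (- U i)" for i x
  define s where "s x = (\<Sum>i\<in>I. d i x)" for x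
  define f where "f x = (\<Sum>i\<in>I. (d i x / s x) *\<^sub>R p i)" for x
  have d_nonneg: "d i x \<ge> 0" for i x
    by (simp add: d_def infdist_nonneg)
  have d_pos: "d i x > 0 \<longleftrightarrow> x \<in> U i" if "i \<in> I" for i x
  proof -
    \<comment> \<open>The point \<open>p i\<close> outside \<open>U i\<close> makes the complement
      nonempty; \<open>infdist\<close> to the empty set is 0 by default, which would spoil the
      equivalence.\<close>
    have "closed (- U i)" "- U i \<noteq> {}"
      using U that False by auto
    then show ?thesis
      using in_closed_iff_infdist_zero[of "- U i" x] d_nonneg[of i x] unfolding d_def by force
  qed
  have s_pos: "s x > 0" if x: "x \<in> D" for x
  proof -
    obtain i where "i \<in> I" "x \<in> U i"
      using cover x unfolding D_def by blast
    then show ?thesis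
      unfolding s_def using I d_nonneg d_pos by (intro sum_pos2[of _ i]) auto
  qed
  have sum1: "(\<Sum>i\<in>I. d i x / s x) = 1" if "x \<in> D" for x
    using s_pos[OF that] by (simp add: sum_divide_distrib[symmetric] flip: s_def)
  have coef: "d i x / s x \<ge> 0" if "x \<in> D" for i x
    using s_pos[OF that] d_nonneg[of i x] by simp
  have D: "compact D" "convex D" "D \<noteq> {}"
    unfolding D_def using I by (simp_all add: compact_convex_hull finite_imp_compact)
  have "continuous_on D f"
    unfolding f_def s_def d_def
    by (intro continuous_intros ballI) (use s_pos in \<open>force simp: s_def d_def\<close>)
  moreover have "f \<in> D \<rightarrow> D"
  proof
    fix x assume x: "x \<in> D"
    show "f x \<in> D"
      unfolding f_def
      by (rule convex_sum[OF I(1) D(2) sum1[OF x] coef[OF x]]) (simp add: D_def hull_inc)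
  qed
  ultimately obtain x where x: "x \<in> D" "f x = x"
    using brouwer[OF D] by blast
  have "x \<in> U j" if j: "j \<in> I" for j
  proof (rule ccontr)
    assume notin: "x \<notin> U j"
    then have zero: "d j x / s x = 0"
      using d_pos[OF j, of x] d_nonneg[of j x] by simp
    have sum_drop: "(\<Sum>i\<in>I - {j}. d i x / s x) = 1"
      using sum1[OF x(1)] zero I(1) j by (simp add: sum.remove)
    have "(\<Sum>i\<in>I - {j}. (d i x / s x) *\<^sub>R p i) \<in> U j"
      by (rule convex_sum[OF _ U(2)[OF j] sum_drop coef[OF x(1)]]) (use I j p in auto)
    moreover have "(\<Sum>i\<in>I - {j}. (d i x / s x) *\<^sub>R p i) = f x"
      unfolding f_def using zero I(1) j by (simp add: sum.remove)
    ultimately show False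
      using notin x(2) by simp
  qed
  then show ?thesis
    using that x(1) unfolding D_def by blast
qed

text \<open>This yields the cover of \<open>U (n + 1)\<close> by
  \<open>U 1, ..., U n\<close>.\<close>

lemma code_C_body_covered:
  assumes "n \<ge> 2" "\<sigma> \<in> code_C n" "n + 1 \<in> \<sigma>"
  shows "\<exists>i\<in>{1..n}. i \<in> \<sigma>"
proof -
  \<comment> \<open>Since \<open>n \<ge> 2\<close>, the part \<open>{1..n} - {i}\<close> of the
    words in the fourth family is nonempty.\<close>
  have "\<exists>j\<in>{1..n}. j \<noteq> i" for i
    using assms(1) by (intro bexI[of _ "if i = 1 then 2 else 1"]) auto
  then show ?thesis
    using assms(2,3) unfolding code_C_def by fastforce
qed

text \<open>All other words meet \<open>{1..n}\<close> in a proper subset. Hence a common point of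
  \<open>U 1, ..., U n\<close> lies in the last petal and in no other.\<close>

lemma code_C_all_facets:
  assumes "n \<ge> 1" "\<sigma> \<in> code_C n" "{1..n} \<subseteq> \<sigma>"
  shows "\<sigma> = {1..n} \<union> {n + 1} \<union> {2 * n + 2}"
proof -
  have "1 \<in> \<sigma>"
    using assms by auto
  then show ?thesis
    using assms unfolding code_C_def by fastforce
qed

text \<open>This is the sunflower property: the last petal meets each other petal only in the common
  center.\<close>

lemma code_C_two_petals:
  assumes "\<sigma> \<in> code_C n" "i \<in> {1..n}" "n + 1 + i \<in> \<sigma>" "2 * n + 2 \<in> \<sigma>"
  shows "\<sigma> = {n + 2..2 * n + 2}"
  using assms unfolding code_C_def by fastforce

theorem theorem4p2:
  fixes n :: nat
  assumes "n \<ge> 2"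
  shows "\<not> convex_code_in TYPE('d::finite) (2 * n + 2) (code_C n)"
proof
  let ?N = "2 * n + 2"
  assume "convex_code_in TYPE('d) ?N (code_C n)"
  then obtain X :: "(real ^ 'd) set" and U :: "nat \<Rightarrow> (real ^ 'd) set"
    where U: "\<And>i. i \<in> {1..?N} \<Longrightarrow> open (U i) \<and> convex (U i) \<and> U i \<subseteq> X"
      and code: "code_C n = code_of ?N X U"
    unfolding convex_code_in_def by blast
  define word where "word x = {i \<in> {1..?N}. x \<in> U i}" for x
  \<comment> \<open>Lying in some \<open>U i\<close> puts \<open>x\<close> in \<open>X\<close>, so
    its word is realized.\<close>
  have word_mem: "word x \<in> code_C n" if "x \<in> U i" "i \<in> {1..?N}" for x i
    using U[OF that(2)] that(1) unfolding code code_of_iff word_def by blast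
  have realize: "\<exists>x. \<forall>i\<in>\<sigma>. x \<in> U i" if "\<sigma> \<in> code_C n" for \<sigma>
    using that unfolding code code_of_iff by blast
  define C where "C = (\<Inter>k\<in>{n + 2..?N}. U k)"
  have "{n + 2..?N} \<in> code_C n"
    by (simp add: code_C_def)
  then have "C \<noteq> {}"
    using realize unfolding C_def by blast
  have petals: "U (n + 1 + i) \<inter> U ?N = C" if i: "i \<in> {1..n}" for i
  proof
    show "U (n + 1 + i) \<inter> U ?N \<subseteq> C"
    proof
      fix x assume x: "x \<in> U (n + 1 + i) \<inter> U ?N"
      then have "word x = {n + 2..?N}"
        using i word_mem[of x ?N] by (intro code_C_two_petals[of _ n i]) (auto simp: word_def)
      then show "x \<in> C"
        unfolding word_def C_def by blast
    qed
    show "C \<subseteq> U (n + 1 + i) \<inter> U ?N"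
      using i by (auto simp: C_def)
  qed
  have "\<exists>x. x \<in> U (n + 1) \<and> x \<in> U (n + 1 + i) \<and> (\<forall>j\<in>{1..n} - {i}. x \<in> U j)"
    if "i \<in> {1..n}" for i
  proof -
    have "({1..n} - {i}) \<union> {n + 1} \<union> {n + 1 + i} \<in> code_C n"
      using that unfolding code_C_def by blast
    from realize[OF this] show ?thesis
      by blast
  qed
  then obtain p where p: "\<And>i. i \<in> {1..n} \<Longrightarrow> p i \<in> U (n + 1)"
      "\<And>i. i \<in> {1..n} \<Longrightarrow> p i \<in> U (n + 1 + i)"
      "\<And>i j. i \<in> {1..n} \<Longrightarrow> j \<in> {1..n} - {i} \<Longrightarrow> p i \<in> U j"
    by metis
  have "convex hull (p ` {1..n}) \<subseteq> U (n + 1)"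
    using p(1) U[of "n + 1"] by (intro hull_minimal) auto
  also have "\<dots> \<subseteq> (\<Union>i\<in>{1..n}. U i)"
  proof
    fix x assume x: "x \<in> U (n + 1)"
    then have "\<exists>i\<in>{1..n}. i \<in> word x"
      using assms word_mem[of x "n + 1"] by (intro code_C_body_covered) (auto simp: word_def)
    then show "x \<in> (\<Union>i\<in>{1..n}. U i)"
      by (auto simp: word_def)
  qed
  finally obtain q where q: "q \<in> convex hull (p ` {1..n})" "\<And>i. i \<in> {1..n} \<Longrightarrow> q \<in> U i"
    using open_cover_convex_hull_common_point[of "{1..n}" U p] U p(3) assms by auto
  have word_q: "word q = {1..n} \<union> {n + 1} \<union> {?N}"
    using assms q(2) word_mem[of q 1] by (intro code_C_all_facets) (auto simp: word_def)
  let ?F = "(\<lambda>i. U (n + 1 + i)) ` {1..n}"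
  have "q \<in> convex hull (\<Union>?F)"
    using q(1) p(2) hull_mono[of "p ` {1..n}" "\<Union>?F" convex] by blast
  moreover have "q \<in> U ?N"
    using word_q unfolding word_def by blast
  moreover have "U ?N \<inter> convex hull (\<Union>?F) \<subseteq> C"
  proof (rule sunflower_petal_Int_convex_hull)
    fix P assume "P \<in> ?F"
    then obtain i where i: "i \<in> {1..n}" "P = U (n + 1 + i)"
      by blast
    then show "open P \<and> convex P \<and> P \<inter> U ?N = C"
      using U[of "n + 1 + i"] petals[OF i(1)] by simp
  qed (use U[of ?N] \<open>C \<noteq> {}\<close> in auto)
  \<comment> \<open>The first petal contains the center, but its index \<open>n + 2\<close> is
    smaller than \<open>2 * n + 2\<close> and so is absent from \<open>word q\<close>.\<close>
  ultimately have "q \<in> U (n + 2)"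
    unfolding C_def by auto
  then have "n + 2 \<in> word q"
    using assms by (auto simp: word_def)
  with word_q assms show False
    by auto
qed

end
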